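(* Let $\rho_{AB}$ be a two-qubit state with Bloch parameters $(\boldsymbol a,\boldsymbol b,T)$, $\boldsymbol b\ne0$, $\boldsymbol n=\boldsymbol b/|\boldsymbol b|$, and let $\Lambda_B$ be a unital qubit channel on Bob, acting on Bloch vectors as $\boldsymbol v\mapsto D\boldsymbol v$ with $D$ a real $3\times3$ matrix (so $\|D\|_{\mathrm{op}}\le1$), such that $D\boldsymbol b\neq0$. Put $\rho_{AB}'=(\mathbb I_A\otimes\Lambda_B)\rho_{AB}$ and $\boldsymbol n'=D\boldsymbol b/|D\boldsymbol b|$. Then $$\mathcal R_{KD}(\rho_{AB}')\le\mathcal R_{KD}(\rho_{AB}),\qquad \mathcal C_{KD}(\rho_{AB}')\le\mathcal C_{KD}(\rho_{AB}).$$ Equality holds in both when $D$ is orthogonal. More generally, for any such $D$, the pointwise inequality $$|D\boldsymbol r-\boldsymbol n'|+|D\boldsymbol r+\boldsymbol n'|\le|\boldsymbol r-\boldsymbol n|+|\boldsymbol r+\boldsymbol n|$$ for Bloch vectors $\boldsymbol r$, $|\boldsymbol r|\le1$, is an equality whenever $\boldsymbol r=0$ or $\boldsymbol r$ is parallel or antiparallel to $\boldsymbol n$; and equality of the optimized quantities follows whenever a measurement of Alice optimal for $\rho_{AB}$ can be chosen all of whose relevant conditional branches (the maximizing outcome for $\mathcal R_{KD}$; all outcomes of nonzero probability for $\mathcal C_{KD}$) have Bloch vectors $\boldsymbol r$ satisfying this alignment condition.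
   Context: A two-qubit state is written $\rho_{AB}=\tfrac14\big[\mathbb I\otimes\mathbb I+\boldsymbol a\cdot\boldsymbol\sigma\otimes\mathbb I+\mathbb I\otimes\boldsymbol b\cdot\boldsymbol\sigma+\sum_{i,j=1}^3T_{ij}\,\sigma_i\otimes\sigma_j\big]$; Bob's reduced state is $\tfrac12(\mathbb I+\boldsymbol b\cdot\boldsymbol\sigma)$. Marginal-adapted KD nonclassicality: for a two-qubit state whose Bob-marginal has Bloch vector $\boldsymbol\beta\neq0$, the reference direction is $\boldsymbol\nu=\boldsymbol\beta/|\boldsymbol\beta|$. With $\Pi_0,\Pi_1$ the eigenprojectors of $\boldsymbol\nu\cdot\boldsymbol\sigma$ and, for an orthonormal qubit basis $\{|b_k\rangle\}_{k=0,1}$, $Q_{ik}(\rho)=\mathrm{Tr}(|b_k\rangle\langle b_k|\,\Pi_i\,\rho)$, set $\mathcal N_{KD}(\rho)=\max_{\{|b_k\rangle\}}\tfrac12\big(\sum_{i,k}|Q_{ik}(\rho)|-1\big)$ over all orthonormal qubit bases. For a POVM $\{M_a\}$ on Alice, $p(a)$ is the probability of outcome $a$ and $\rho_{B|a}$ is Bob's conditional state $\mathrm{Tr}_A[(M_a\otimes\mathbb I)\,\cdot\,]/p(a)$. Then $\mathcal R_{KD}=\max_{\{M_a\},a}\mathcal N_{KD}(\rho_{B|a})$ (all POVMs, all outcomes of nonzero probability) and $\mathcal C_{KD}=\max_{\{M_a\}}\sum_ap(a)\,\mathcal N_{KD}(\rho_{B|a})$ (all POVMs). For $\rho_{AB}$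 the reference direction is $\boldsymbol n$; for $\rho'_{AB}$, whose Bob-marginal has Bloch vector $D\boldsymbol b$, it is $\boldsymbol n'$. A unital qubit channel is a completely positive trace-preserving map on $2\times2$ matrices fixing the identity; on Bloch vectors it acts linearly. *)

theory Defs
  imports "HOL-Analysis.Analysis"
begin

section \<open>Qubit operators\<close>

type_synonym qubit_op = "complex^2^2"
type_synonym two_qubit_op = "complex^(2 \<times> 2)^(2 \<times> 2)"

definition hadj :: "complex^'n^'m \<Rightarrow> complex^'m^'n" where
  "hadj A = (\<chi> i j. cnj (A $ j $ i))"

definition psd :: "complex^'n^'n \<Rightarrow> bool" where
  "psd A \<longleftrightarrow> (\<forall>v. let q = (\<Sum>i\<in>UNIV. cnj (v $ i) * (A *v v) $ i) in Im q = 0 \<and> 0 \<le> Re q)"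

definition density_op :: "complex^'n^'n \<Rightarrow> bool" where
  "density_op \<rho> \<longleftrightarrow> psd \<rho> \<and> trace \<rho> = 1"

definition pauli :: "3 \<Rightarrow> qubit_op" where
  "pauli i = (if i = 1 then vector [vector [0, 1], vector [1, 0]]
         else if i = 2 then vector [vector [0, - \<i>], vector [\<i>, 0]]
         else vector [vector [1, 0], vector [0, - 1]])"

definition dot_sigma :: "real^3 \<Rightarrow> qubit_op" where
  "dot_sigma v = (\<Sum>i\<in>UNIV. v $ i *\<^sub>R pauli i)"

definition bloch_op :: "real^3 \<Rightarrow> qubit_op" where
  "bloch_op v = (1/2) *\<^sub>R (mat 1 + dot_sigma v)"

definition bloch_vec :: "qubit_op \<Rightarrow> real^3" where
  "bloch_vec \<rho> = (\<chi> i. Re (trace (pauli i ** \<rho>)))"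

section \<open>Two qubits: the first factor is Alice, the second is Bob\<close>

definition kron :: "qubit_op \<Rightarrow> qubit_op \<Rightarrow> two_qubit_op" (infixl "\<otimes>" 72) where
  "A \<otimes> B = (\<chi> p q. A $ fst p $ fst q * B $ snd p $ snd q)"

definition ptrace_A :: "two_qubit_op \<Rightarrow> qubit_op" where
  "ptrace_A X = (\<chi> k l. \<Sum>i\<in>UNIV. X $ (i, k) $ (i, l))"

definition two_qubit :: "real^3 \<Rightarrow> real^3 \<Rightarrow> real^3^3 \<Rightarrow> two_qubit_op" where
  "two_qubit a b T = (1/4) *\<^sub>R (mat 1 \<otimes> mat 1 + dot_sigma a \<otimes> mat 1 + mat 1 \<otimes> dot_sigma b
     + (\<Sum>i\<in>UNIV. \<Sum>j\<in>UNIV. T $ i $ j *\<^sub>R (pauli i \<otimes> pauli j)))"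

section \<open>Channels\<close>

(* The product mat c ** X is multiplication of X by the complex scalar c. *)
definition complex_linear_op :: "(qubit_op \<Rightarrow> qubit_op) \<Rightarrow> bool" where
  "complex_linear_op \<Lambda> \<longleftrightarrow>
     (\<forall>X Y. \<Lambda> (X + Y) = \<Lambda> X + \<Lambda> Y) \<and> (\<forall>c X. \<Lambda> (mat c ** X) = mat c ** \<Lambda> X)"

(* Positivity of the operator on C^n (x) C^2 whose 2x2 block at (i, j), for i, j < n, is X i j.
   Blocks are indexed by nat so that the ancilla dimension n can be quantified in a definition. *)
definition block_psd :: "nat \<Rightarrow> (nat \<Rightarrow> nat \<Rightarrow> qubit_op) \<Rightarrow> bool" where
  "block_psd n X \<longleftrightarrow> (\<forall>v :: nat \<Rightarrow> complex^2.
     let q = (\<Sum>i<n. \<Sum>j<n. \<Sum>k\<in>UNIV. cnj (v i $ k) * (X i j *v v j) $ k)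
     in Im q = 0 \<and> 0 \<le> Re q)"

definition completely_positive :: "(qubit_op \<Rightarrow> qubit_op) \<Rightarrow> bool" where
  "completely_positive \<Lambda> \<longleftrightarrow> (\<forall>n X. block_psd n X \<longrightarrow> block_psd n (\<lambda>i j. \<Lambda> (X i j)))"

definition unital_channel :: "(qubit_op \<Rightarrow> qubit_op) \<Rightarrow> bool" where
  "unital_channel \<Lambda> \<longleftrightarrow> complex_linear_op \<Lambda> \<and> completely_positive \<Lambda>
     \<and> (\<forall>X. trace (\<Lambda> X) = trace X) \<and> \<Lambda> (mat 1) = mat 1"

(* For linear maps L this is id (x) L: it applies L to each of the four blocks <i|X|j>, where
   |i>, |j> are Alice's computational basis vectors. *)
definition id_tensor :: "(qubit_op \<Rightarrow> qubit_op) \<Rightarrow> two_qubit_op \<Rightarrow> two_qubit_op" where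
  "id_tensor \<Lambda> X = (\<chi> p q. \<Lambda> (\<chi> k l. X $ (fst p, k) $ (fst q, l)) $ snd p $ snd q)"

section \<open>Kirkwood-Dirac nonclassicality\<close>

definition eigenprojector :: "complex^'n^'n \<Rightarrow> complex \<Rightarrow> complex^'n^'n" where
  "eigenprojector A l =
     (THE P. P ** P = P \<and> hadj P = P \<and> (\<forall>v. P *v v = v \<longleftrightarrow> A *v v = l *s v))"

definition ref_projector :: "real^3 \<Rightarrow> 2 \<Rightarrow> qubit_op" where
  "ref_projector \<nu> i = eigenprojector (dot_sigma \<nu>) (if i = 0 then 1 else - 1)"

lemma eigenprojector_eqI:
  assumes "P ** P = P" "hadj P = P" "\<And>v. P *v v = v \<longleftrightarrow> A *v v = l *s v"
  shows "eigenprojector A l = P"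
  unfolding eigenprojector_def
proof (rule the_equality)
  show "P ** P = P \<and> hadj P = P \<and> (\<forall>v. P *v v = v \<longleftrightarrow> A *v v = l *s v)"
    using assms by blast
next
  have had: "hadj (X ** Y) = hadj Y ** hadj X" for X Y :: "complex^'a^'a"
    by (simp add: hadj_def matrix_matrix_mult_def vec_eq_iff mult.commute)
  have prod: "X ** Y = Y" if "Y ** Y = Y" "\<And>v. Y *v v = v \<Longrightarrow> X *v v = v" for X Y :: "complex^'a^'a"
  proof (subst matrix_eq, rule allI)
    fix v
    have "Y *v (Y *v v) = Y *v v" by (simp add: matrix_vector_mul_assoc that(1))
    from that(2)[OF this] show "(X ** Y) *v v = Y *v v" by (simp add: matrix_vector_mul_assoc)
  qed
  fix Q assume Q: "Q ** Q = Q \<and> hadj Q = Q \<and> (\<forall>v. Q *v v = v \<longleftrightarrow> A *v v = l *s v)"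
  have "P ** Q = Q" "Q ** P = P" using prod Q assms by blast+
  then show "Q = P" using had Q assms(2) by metis
qed

lemma ref_projector_eq:
  assumes "norm \<nu> = 1"
  shows "ref_projector \<nu> i = (1/2) *\<^sub>R (mat 1 + (if i = 0 then 1 else - 1) *\<^sub>R dot_sigma \<nu>)"
proof -
  define s :: real where "s = (if i = 0 then 1 else - 1)"
  let ?S = "dot_sigma \<nu>" and ?P = "(1/2) *\<^sub>R (mat 1 + s *\<^sub>R dot_sigma \<nu>)"
  have s: "s * s = 1" "of_real s * of_real s = (1::complex)" by (auto simp: s_def)
  have n: "(\<nu>$1)\<^sup>2 + (\<nu>$2)\<^sup>2 + (\<nu>$3)\<^sup>2 = 1"
    using assms by (simp add: norm_vec_def L2_set_def sum_3)
  have S: "?S $ 1 $ 1 = \<nu>$3" "?S $ 2 $ 2 = - \<nu>$3" "?S $ 1 $ 2 = Complex (\<nu>$1) (- \<nu>$2)"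
    "?S $ 2 $ 1 = Complex (\<nu>$1) (\<nu>$2)"
    by (simp_all add: dot_sigma_def pauli_def sum_3 complex_eq_iff)
  have SS: "?S ** ?S = mat 1"
    using n by (simp add: vec_eq_iff matrix_matrix_mult_def forall_2 sum_2 S mat_def complex_eq_iff power2_eq_square algebra_simps)
  have hS: "hadj ?S = ?S" by (simp add: vec_eq_iff hadj_def forall_2 S complex_eq_iff)
  have sc: "(c *\<^sub>R X) ** Y = c *\<^sub>R (X ** Y)" "X ** (c *\<^sub>R Y) = c *\<^sub>R (X ** Y)"
    for c and X Y :: "complex^2^2"
    by (simp_all add: vec_eq_iff matrix_matrix_mult_def scaleR_right.sum)
  have scv: "(c *\<^sub>R X) *v y = c *\<^sub>R (X *v y)" "X *v (c *\<^sub>R y) = c *\<^sub>R (X *v y)"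
    for c and X :: "complex^2^2" and y
    by (simp_all add: vec_eq_iff matrix_vector_mult_def scaleR_right.sum)
  have rd: "(X + Y) ** Z = X ** Z + Y ** Z" for X Y Z :: "complex^2^2"
    by (simp add: vec_eq_iff matrix_matrix_mult_def distrib_right sum.distrib)
  have "?P ** ?P = (1/4) *\<^sub>R (mat 1 + s *\<^sub>R ?S + (s *\<^sub>R ?S + (s * s) *\<^sub>R mat 1))"
    by (simp only: sc rd matrix_add_ldistrib SS scaleR_scaleR) (simp add: scaleR_add_right)
  also have "\<dots> = ?P" by (simp add: s(1) vec_eq_iff complex_eq_iff)
  finally have 1: "?P ** ?P = ?P" .
  have 2: "hadj ?P = ?P"
    using hS by (simp add: vec_eq_iff hadj_def mat_def)
  have 3: "?P *v v = v \<longleftrightarrow> ?S *v v = of_real s *s v" for v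
  proof -
    have "?P *v v = v \<longleftrightarrow> v + s *\<^sub>R (?S *v v) = 2 *\<^sub>R v"
      by (simp add: scv matrix_vector_mult_add_rdistrib vec_eq_iff complex_eq_iff)
    also have "\<dots> \<longleftrightarrow> s *\<^sub>R (?S *v v) = v" by (simp add: scaleR_2)
    also have "\<dots> \<longleftrightarrow> ?S *v v = s *\<^sub>R v" by (auto simp: s_def minus_equation_iff)
    also have "s *\<^sub>R v = of_real s *s v" by (simp add: vec_eq_iff complex_eq_iff)
    finally show ?thesis .
  qed
  show ?thesis
    using eigenprojector_eqI[OF 1 2 3] unfolding ref_projector_def s_def by (simp split: if_splits)
qed

definition orthonormal_basis :: "(2 \<Rightarrow> complex^2) \<Rightarrow> bool" where
  "orthonormal_basis e \<longleftrightarrow>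
     (\<forall>k l. (\<Sum>i\<in>UNIV. cnj (e k $ i) * e l $ i) = (if k = l then 1 else 0))"

definition ketbra :: "complex^2 \<Rightarrow> qubit_op" where
  "ketbra v = (\<chi> i j. v $ i * cnj (v $ j))"

definition KD :: "real^3 \<Rightarrow> (2 \<Rightarrow> complex^2) \<Rightarrow> qubit_op \<Rightarrow> 2 \<Rightarrow> 2 \<Rightarrow> complex" where
  "KD \<nu> e \<rho> i k = trace (ketbra (e k) ** ref_projector \<nu> i ** \<rho>)"

(* Here and below, maxima over bases and measurements are written as suprema; these sets of
   reals are nonempty and bounded above for unit reference directions, and the suprema are attained. *)
definition N_KD :: "real^3 \<Rightarrow> qubit_op \<Rightarrow> real" where
  "N_KD \<nu> \<rho> = (SUP e \<in> Collect orthonormal_basis.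
     (1/2) * ((\<Sum>i\<in>UNIV. \<Sum>k\<in>UNIV. cmod (KD \<nu> e \<rho> i k)) - 1))"

definition ref_dir :: "two_qubit_op \<Rightarrow> real^3" where
  "ref_dir \<rho> = (let \<beta> = bloch_vec (ptrace_A \<rho>) in \<beta> /\<^sub>R norm \<beta>)"

lemma ref_dir_two_qubit: "ref_dir (two_qubit a b T) = b /\<^sub>R norm b"
proof -
  have "bloch_vec (ptrace_A (two_qubit a b T)) = b"
    by (simp add: vec_eq_iff bloch_vec_def ptrace_A_def two_qubit_def kron_def trace_def
        matrix_matrix_mult_def forall_3 sum_3 sum_2 pauli_def dot_sigma_def mat_def)
      (simp add: field_simps)
  then show ?thesis by (simp add: ref_dir_def)
qed

definition povm :: "qubit_op list \<Rightarrow> bool" where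
  "povm Ms \<longleftrightarrow> (\<forall>M \<in> set Ms. psd M) \<and> sum_list Ms = mat 1"

definition outcome_prob :: "two_qubit_op \<Rightarrow> qubit_op \<Rightarrow> real" where
  "outcome_prob \<rho> M = Re (trace ((M \<otimes> mat 1) ** \<rho>))"

definition cond_state :: "two_qubit_op \<Rightarrow> qubit_op \<Rightarrow> qubit_op" where
  "cond_state \<rho> M = ptrace_A ((M \<otimes> mat 1) ** \<rho>) /\<^sub>R outcome_prob \<rho> M"

definition R_KD :: "two_qubit_op \<Rightarrow> real" where
  "R_KD \<rho> = Sup {N_KD (ref_dir \<rho>) (cond_state \<rho> M) | Ms M.
     povm Ms \<and> M \<in> set Ms \<and> outcome_prob \<rho> M \<noteq> 0}"

(* Outcomes of probability zero contribute zero to the sum. *)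
definition avg_N_KD :: "two_qubit_op \<Rightarrow> qubit_op list \<Rightarrow> real" where
  "avg_N_KD \<rho> Ms = (\<Sum>M\<leftarrow>Ms. outcome_prob \<rho> M * N_KD (ref_dir \<rho>) (cond_state \<rho> M))"

definition C_KD :: "two_qubit_op \<Rightarrow> real" where
  "C_KD \<rho> = (SUP Ms \<in> Collect povm. avg_N_KD \<rho> Ms)"

definition aligned :: "real^3 \<Rightarrow> real^3 \<Rightarrow> bool" where
  "aligned n r \<longleftrightarrow> r = 0 \<or> (\<exists>c>0. r = c *\<^sub>R n) \<or> (\<exists>c<0. r = c *\<^sub>R n)"

end

theory Submission
  imports Defs
begin

text \<open>
  For a unit direction \<open>\<nu>\<close> and a state with Bloch vector \<open>r\<close>, maximizing over bases gives the
  nonclassicality \<open>((|r - \<nu>| + |r + \<nu>|) / 2 - 1) / 2\<close>, an increasing function of the sum of distances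
  to the two foci \<open>\<plusminus>\<nu>\<close>. The channel maps a conditional Bloch vector \<open>r\<close> to \<open>D r\<close> without changing the
  outcome probabilities, and \<open>D\<close> is a contraction with \<open>D n\<close> parallel to \<open>n'\<close>; hence neither the norm
  nor the distance to the line through the foci increases. Inside the unit ball the sum of distances
  is increasing in both of these quantities, and it is constantly 2 on the segment between the foci.
\<close>

section \<open>Qubit operators and Bloch vectors\<close>

lemma cmod_sq: "(of_real (cmod z))\<^sup>2 = z * cnj z"
  using complex_norm_square[of z] by simp

lemma norm_vec2_sq: "(norm (x :: complex^2))\<^sup>2 = (cmod (x $ 1))\<^sup>2 + (cmod (x $ 2))\<^sup>2"
  by (simp add: norm_vec_def L2_set_def sum_2)

lemma norm_vec3_sq: "(norm (x :: real^3))\<^sup>2 = (x $ 1)\<^sup>2 + (x $ 2)\<^sup>2 + (x $ 3)\<^sup>2"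
  by (simp add: norm_vec_def L2_set_def sum_3)

lemma inner_vec3: "(x :: real^3) \<bullet> y = x $ 1 * y $ 1 + x $ 2 * y $ 2 + x $ 3 * y $ 3"
  by (simp add: inner_vec_def sum_3)

lemma dot_sigma_nth:
  "dot_sigma v $ 1 $ 1 = Complex (v $ 3) 0" "dot_sigma v $ 2 $ 2 = Complex (- v $ 3) 0"
  "dot_sigma v $ 1 $ 2 = Complex (v $ 1) (- v $ 2)" "dot_sigma v $ 2 $ 1 = Complex (v $ 1) (v $ 2)"
  by (simp_all add: dot_sigma_def pauli_def sum_3 complex_eq_iff)

lemma bloch_op_nth:
  "bloch_op v $ 1 $ 1 = Complex ((1 + v $ 3) / 2) 0"
  "bloch_op v $ 2 $ 2 = Complex ((1 - v $ 3) / 2) 0"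
  "bloch_op v $ 1 $ 2 = Complex (v $ 1 / 2) (- v $ 2 / 2)"
  "bloch_op v $ 2 $ 1 = Complex (v $ 1 / 2) (v $ 2 / 2)"
  by (simp_all add: bloch_op_def mat_def dot_sigma_nth complex_eq_iff)

lemma bloch_vec_nth:
  "bloch_vec X $ 1 = Re (X $ 2 $ 1) + Re (X $ 1 $ 2)"
  "bloch_vec X $ 2 = Im (X $ 2 $ 1) - Im (X $ 1 $ 2)"
  "bloch_vec X $ 3 = Re (X $ 1 $ 1) - Re (X $ 2 $ 2)"
  by (simp_all add: bloch_vec_def pauli_def trace_def matrix_matrix_mult_def sum_2)

lemma trace_bloch_op: "trace (bloch_op v) = 1"
  by (simp add: trace_def sum_2 bloch_op_nth complex_eq_iff field_simps)

lemma bloch_vec_bloch_op: "bloch_vec (bloch_op v) = v"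
  by (simp add: vec_eq_iff forall_3 bloch_vec_nth bloch_op_nth field_simps)

lemma bloch_vec_scaleR: "bloch_vec (c *\<^sub>R X) = c *\<^sub>R bloch_vec X"
  by (simp add: vec_eq_iff forall_3 bloch_vec_nth algebra_simps)

text \<open>The trace is left free because the operators steered by a measurement outcome are not
  normalized.\<close>

lemma hermitian_qubit_nth:
  assumes "hadj X = (X :: qubit_op)"
  shows "X $ 1 $ 1 = Complex ((Re (trace X) + bloch_vec X $ 3) / 2) 0"
    "X $ 2 $ 2 = Complex ((Re (trace X) - bloch_vec X $ 3) / 2) 0"
    "X $ 1 $ 2 = Complex (bloch_vec X $ 1 / 2) (- bloch_vec X $ 2 / 2)"
    "X $ 2 $ 1 = Complex (bloch_vec X $ 1 / 2) (bloch_vec X $ 2 / 2)"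
proof -
  have "cnj (X $ j $ i) = X $ i $ j" for i j
    using assms by (auto simp: hadj_def vec_eq_iff)
  from this[of 1 1] this[of 2 2] this[of 1 2]
  show "X $ 1 $ 1 = Complex ((Re (trace X) + bloch_vec X $ 3) / 2) 0"
    "X $ 2 $ 2 = Complex ((Re (trace X) - bloch_vec X $ 3) / 2) 0"
    "X $ 1 $ 2 = Complex (bloch_vec X $ 1 / 2) (- bloch_vec X $ 2 / 2)"
    "X $ 2 $ 1 = Complex (bloch_vec X $ 1 / 2) (bloch_vec X $ 2 / 2)"
    by (auto simp: complex_eq_iff bloch_vec_nth trace_def sum_2)
qed

lemma bloch_op_bloch_vec:
  assumes "hadj X = X" "Re (trace X) = 1"
  shows "bloch_op (bloch_vec X) = X"
  using hermitian_qubit_nth[OF assms(1)] assms(2)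
  by (simp add: vec_eq_iff forall_2 bloch_op_nth)

text \<open>The identity and the Pauli matrices are orthogonal for the trace form, each with square
  2; here this is checked on entries.\<close>

lemma trace_mult_hermitian_qubit:
  assumes "hadj X = (X :: qubit_op)" "hadj Y = Y"
  shows "trace (X ** Y)
    = of_real ((Re (trace X) * Re (trace Y) + bloch_vec X \<bullet> bloch_vec Y) / 2)"
proof -
  \<comment> \<open>The abbreviations keep the simplifier from expanding traces and Bloch vectors
    back into matrix entries.\<close>
  define t u x y where "t = Re (trace X)" "u = Re (trace Y)" "x = bloch_vec X" "y = bloch_vec Y"
  note d = this
  show ?thesis
    unfolding d[symmetric]
    by (simp add: trace_def matrix_matrix_mult_def sum_2 inner_vec3 complex_eq_iff
        hermitian_qubit_nth[OF assms(1), folded d] hermitian_qubit_nth[OF assms(2), folded d])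
      (simp add: diff_divide_distrib add_divide_distrib algebra_simps)
qed

section \<open>Rank-one operators and orthonormal bases on the Bloch sphere\<close>

lemma hadj_ketbra: "hadj (ketbra x) = ketbra x"
  by (simp add: hadj_def ketbra_def vec_eq_iff mult.commute)

lemma trace_ketbra: "trace (ketbra x) = of_real ((norm x)\<^sup>2)"
  by (simp add: trace_def ketbra_def sum_2 norm_vec2_sq cmod_sq)

text \<open>A rank-one operator has determinant 0, and four times the determinant of a Hermitian
  operator is its squared trace minus the squared length of its Bloch vector.\<close>

lemma norm_bloch_vec_ketbra: "norm (bloch_vec (ketbra x)) = (norm x)\<^sup>2"
proof -
  have "(norm (bloch_vec (ketbra x)))\<^sup>2 = ((norm x)\<^sup>2)\<^sup>2"
    by (simp add: norm_vec3_sq norm_vec2_sq cmod_power2 bloch_vec_nth ketbra_def)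
      (simp add: power2_eq_square algebra_simps)
  then show ?thesis by (rule power2_eq_imp_eq) simp_all
qed

text \<open>Gives access to the trace formula, so that positivity becomes a Cauchy-Schwarz argument
  on Bloch vectors.\<close>

lemma quadratic_form_eq_trace:
  "(\<Sum>i\<in>UNIV. cnj (v $ i) * (A *v v) $ i) = trace (ketbra v ** A)"
  by (simp add: trace_def ketbra_def matrix_matrix_mult_def matrix_vector_mult_def sum_2
      algebra_simps)

lemma ex_basis_bloch:
  assumes "norm k = 1"
  obtains e where "orthonormal_basis e" "ketbra (e 1) = bloch_op (- k)" "ketbra (e 2) = bloch_op k"
proof -
  have k: "(k $ 1)\<^sup>2 + (k $ 2)\<^sup>2 + (k $ 3)\<^sup>2 = 1"
    using assms norm_vec3_sq[of k] by simp
  show thesis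
  \<comment> \<open>The general eigenvector formula degenerates at the south pole, where the
    computational basis serves instead.\<close>
  proof (cases "k $ 3 = - 1")
    case True
    with k have k12: "k $ 1 = 0" "k $ 2 = 0" by (auto simp: add_nonneg_eq_0_iff)
    define e :: "2 \<Rightarrow> complex^2" where "e j = (if j = 1 then vector [1, 0] else vector [0, 1])" for j
    have "orthonormal_basis e"
      by (simp add: orthonormal_basis_def forall_2 e_def sum_2)
    moreover have "ketbra (e 1) = bloch_op (- k)" "ketbra (e 2) = bloch_op k"
      by (simp_all add: vec_eq_iff forall_2 ketbra_def e_def bloch_op_nth True k12 complex_eq_iff)
    ultimately show thesis using that by blast
  next
    case False
    have "(k $ 3)\<^sup>2 \<le> 1" using k by (smt (verit) zero_le_power2)
    then have "- 1 \<le> k $ 3" by (metis abs_le_iff abs_le_square_iff abs_one minus_le_iff one_power2)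
    with False have pos: "0 < 1 + k $ 3" by simp
    \<comment> \<open>\<open>N\<close> is the squared length of both unnormalized eigenvectors
      below: (1 + k3)^2 + k1^2 + k2^2 = 2 (1 + k3) on the unit sphere.\<close>
    define N where "N = 2 * (1 + k $ 3)"
    have N: "0 < N" using pos by (simp add: N_def)
    define s where "s = 1 / sqrt N"
    have ss: "s * s = 1 / N" using N by (simp add: s_def)
    define e :: "2 \<Rightarrow> complex^2" where "e j = s *\<^sub>R (if j = 1 then
      vector [Complex (- k $ 1) (k $ 2), Complex (1 + k $ 3) 0]
      else vector [Complex (1 + k $ 3) 0, Complex (k $ 1) (k $ 2)])" for j
    have k': "k $ 1 * k $ 1 + k $ 2 * k $ 2 = (1 + k $ 3) * (1 - k $ 3)"
      using k by (simp add: power2_eq_square algebra_simps)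
    have s2: "s * (s * x) = x / N" for x
      by (simp add: mult.assoc[symmetric] ss)
    have "orthonormal_basis e"
      unfolding orthonormal_basis_def
      by (simp add: forall_2 e_def sum_2 complex_eq_iff algebra_simps s2 ss)
        (simp add: add_divide_distrib[symmetric] diff_divide_distrib[symmetric],
          use N k' in \<open>simp add: N_def field_simps\<close>)
    moreover have "ketbra (e 1) = bloch_op (- k)" "ketbra (e 2) = bloch_op k"
      by (simp_all add: vec_eq_iff forall_2 ketbra_def e_def bloch_op_nth complex_eq_iff
          algebra_simps s2 ss)
        (simp_all add: add_divide_distrib[symmetric] diff_divide_distrib[symmetric],
          use N k' in \<open>simp_all add: N_def field_simps\<close>)
    ultimately show thesis using that by blast
  qed
qed

text \<open>The trace of the product of the two projectors is the squared modulus of the overlap,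
  hence 0. The two unit Bloch vectors thus have inner product -1 and are antipodal.\<close>

lemma orthonormal_basis_bloch:
  assumes "orthonormal_basis e"
  obtains k where "norm k = 1" "ketbra (e 1) = bloch_op (- k)" "ketbra (e 2) = bloch_op k"
proof -
  have n: "norm (e j) = 1" for j
  proof -
    have "of_real ((norm (e j))\<^sup>2) = (\<Sum>i\<in>UNIV. cnj (e j $ i) * e j $ i)"
      by (simp add: norm_vec2_sq sum_2 cmod_sq mult.commute)
    also have "\<dots> = 1" using assms by (simp add: orthonormal_basis_def)
    finally have "(norm (e j))\<^sup>2 = 1" using of_real_eq_1_iff by blast
    then show ?thesis using power2_eq_1_iff by (smt (verit) norm_ge_zero)
  qed
  let ?k = "\<lambda>j. bloch_vec (ketbra (e j))"
  have k: "ketbra (e j) = bloch_op (?k j)" "norm (?k j) = 1" for j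
    by (simp_all add: bloch_op_bloch_vec hadj_ketbra trace_ketbra norm_bloch_vec_ketbra n)
  have "trace (ketbra (e 1) ** ketbra (e 2)) = 
    (\<Sum>i\<in>UNIV. cnj (e 1 $ i) * e 2 $ i) * (\<Sum>i\<in>UNIV. cnj (e 2 $ i) * e 1 $ i)"
    by (simp add: trace_def matrix_matrix_mult_def ketbra_def sum_2 algebra_simps)
  then have "trace (ketbra (e 1) ** ketbra (e 2)) = 0"
    using assms by (simp add: orthonormal_basis_def)
  then have "?k 1 \<bullet> ?k 2 = - 1"
    unfolding trace_mult_hermitian_qubit[OF hadj_ketbra hadj_ketbra] of_real_eq_0_iff
    by (simp add: trace_ketbra n)
  moreover have "?k j \<bullet> ?k j = 1" for j using k by (simp add: dot_square_norm)
  ultimately have "(?k 1 + ?k 2) \<bullet> (?k 1 + ?k 2) = 0"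
    by (simp add: inner_add_left inner_add_right inner_commute[of "?k 2" "?k 1"])
  then have "?k 1 + ?k 2 = 0" by (simp only: inner_eq_zero_iff)
  then have "?k 1 = - ?k 2" by (simp add: eq_neg_iff_add_eq_0)
  with k that[of "?k 2"] show thesis by metis
qed

text \<open>The eigenvalues of a Hermitian qubit operator are half of its trace plus or minus the
  length of its Bloch vector.\<close>

lemma psd_qubit_iff:
  "psd (X :: qubit_op) \<longleftrightarrow> hadj X = X \<and> norm (bloch_vec X) \<le> Re (trace X)"
proof
  assume X: "psd X"
  define q where "q v = (\<Sum>i\<in>UNIV. cnj (v $ i) * (X *v v) $ i)" for v
  have q: "Im (q v) = 0" "0 \<le> Re (q v)" for v
    using X by (simp_all add: psd_def q_def Let_def)
  have "hadj X = X"
    \<comment> \<open>Polarization: real values on these four vectors already force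
      Hermiticity.\<close>
    using q(1)[of "vector [1, 0]"] q(1)[of "vector [0, 1]"] q(1)[of "vector [1, 1]"]
      q(1)[of "vector [1, \<i>]"]
    by (simp add: q_def sum_2 matrix_vector_mult_def vec_eq_iff forall_2 hadj_def complex_eq_iff)
  moreover have "norm (bloch_vec X) \<le> Re (trace X)"
  proof (cases "bloch_vec X = 0")
    case True
    have "0 \<le> Re (trace X)"
      using q(2)[of "vector [1, 0]"] q(2)[of "vector [0, 1]"]
      by (simp add: q_def sum_2 matrix_vector_mult_def trace_def)
    with True show ?thesis by simp
  next
    case False
    \<comment> \<open>The Bloch direction of the eigenvector of the smaller eigenvalue.\<close>
    define k where "k = - (bloch_vec X /\<^sub>R norm (bloch_vec X))"
    have "norm k = 1" using False by (simp add: k_def)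
    then obtain e :: "2 \<Rightarrow> complex^2" where e: "ketbra (e 2) = bloch_op k" using ex_basis_bloch by metis
    have "Re (q (e 2)) = (Re (trace X) + k \<bullet> bloch_vec X) / 2"
      unfolding q_def quadratic_form_eq_trace
        trace_mult_hermitian_qubit[OF hadj_ketbra \<open>hadj X = X\<close>] Re_complex_of_real
      by (simp add: e trace_bloch_op bloch_vec_bloch_op)
    moreover have "k \<bullet> bloch_vec X = - norm (bloch_vec X)"
      using False by (simp add: k_def dot_square_norm power2_eq_square)
    ultimately show ?thesis using q(2)[of "e 2"] by simp
  qed
  ultimately show "hadj X = X \<and> norm (bloch_vec X) \<le> Re (trace X)" by blast
next
  assume X: "hadj X = X \<and> norm (bloch_vec X) \<le> Re (trace X)"
  have "0 \<le> (norm v)\<^sup>2 * Re (trace X) + bloch_vec (ketbra v) \<bullet> bloch_vec X" for v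
  proof -
    have "\<bar>bloch_vec (ketbra v) \<bullet> bloch_vec X\<bar> \<le> (norm v)\<^sup>2 * norm (bloch_vec X)"
      using Cauchy_Schwarz_ineq2[of "bloch_vec (ketbra v)" "bloch_vec X"]
      by (simp add: norm_bloch_vec_ketbra)
    also have "\<dots> \<le> (norm v)\<^sup>2 * Re (trace X)" using X by (simp add: mult_left_mono)
    finally show ?thesis by linarith
  qed
  with X show "psd X"
    by (simp add: psd_def quadratic_form_eq_trace trace_mult_hermitian_qubit hadj_ketbra trace_ketbra)
qed

lemma psd_bloch_op_iff: "psd (bloch_op v) \<longleftrightarrow> norm v \<le> 1"
proof -
  have "hadj (bloch_op v) = bloch_op v"
    by (simp add: vec_eq_iff forall_2 hadj_def bloch_op_nth complex_eq_iff)
  then show ?thesis by (simp add: psd_qubit_iff trace_bloch_op bloch_vec_bloch_op)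
qed

lemma psd_qubit_trace_mult:
  assumes "psd (X :: qubit_op)" "psd Y"
  shows "Im (trace (X ** Y)) = 0" "0 \<le> Re (trace (X ** Y))"
proof -
  have h: "hadj X = X" "norm (bloch_vec X) \<le> Re (trace X)"
    "hadj Y = Y" "norm (bloch_vec Y) \<le> Re (trace Y)"
    using assms by (simp_all add: psd_qubit_iff)
  have "\<bar>bloch_vec X \<bullet> bloch_vec Y\<bar> \<le> Re (trace X) * Re (trace Y)"
    by (rule order_trans[OF Cauchy_Schwarz_ineq2 mult_mono])
      (use h in \<open>auto intro: order_trans[OF norm_ge_zero]\<close>)
  then show "Im (trace (X ** Y)) = 0" "0 \<le> Re (trace (X ** Y))"
    by (simp_all add: trace_mult_hermitian_qubit h)
qed

section \<open>Sums of distances to two antipodal foci\<close>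

text \<open>The product of the two distances has square (1 + s)^2 - 4 c^2 = (1 - s)^2 + 4 (s - c^2)
  with s = |x|^2 and c = \<open>x \<bullet> u\<close>. This isolates s - c^2, the squared distance
  to the line through the foci.\<close>

lemma focal_sum_sq:
  fixes x u :: "'a::real_inner"
  assumes "norm u = 1"
  shows "(norm (x - u) + norm (x + u))\<^sup>2
    = 2 * (1 + (norm x)\<^sup>2) + 2 * sqrt ((1 - (norm x)\<^sup>2)\<^sup>2 + 4 * ((norm x)\<^sup>2 - (x \<bullet> u)\<^sup>2))"
proof -
  have u: "u \<bullet> u = 1" using assms by (simp add: dot_square_norm)
  have m: "(norm (x - u))\<^sup>2 = 1 + (norm x)\<^sup>2 - 2 * (x \<bullet> u)"
    and p: "(norm (x + u))\<^sup>2 = 1 + (norm x)\<^sup>2 + 2 * (x \<bullet> u)"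
    by (simp_all add: power2_norm_eq_inner inner_diff_left inner_diff_right inner_add_left
        inner_add_right u inner_commute[of u x])
  have "norm (x - u) * norm (x + u) = sqrt ((norm (x - u))\<^sup>2 * (norm (x + u))\<^sup>2)"
    by (simp add: real_sqrt_mult)
  also have "(norm (x - u))\<^sup>2 * (norm (x + u))\<^sup>2
    = (1 - (norm x)\<^sup>2)\<^sup>2 + 4 * ((norm x)\<^sup>2 - (x \<bullet> u)\<^sup>2)"
    unfolding m p by (simp add: power2_eq_square algebra_simps)
  finally show ?thesis by (simp add: power2_sum m p)
qed

text \<open>The term (1 - s)^2 under the root shrinks as s grows to 1, but the root falls at most at
  unit rate in s, which the linear term in s outside the root offsets.\<close>

lemma focal_sum_mono:
  fixes x u :: "'a::real_inner" and r w :: "'b::real_inner"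
  assumes "norm u = 1" "norm w = 1" "norm x \<le> norm r" "norm r \<le> 1"
    and "(norm x)\<^sup>2 - (x \<bullet> u)\<^sup>2 \<le> (norm r)\<^sup>2 - (r \<bullet> w)\<^sup>2"
  shows "norm (x - u) + norm (x + u) \<le> norm (r - w) + norm (r + w)"
proof -
  define s s' p p' where "s = (norm x)\<^sup>2" "s' = (norm r)\<^sup>2"
    "p = (norm x)\<^sup>2 - (x \<bullet> u)\<^sup>2" "p' = (norm r)\<^sup>2 - (r \<bullet> w)\<^sup>2"
  note d = this
  have ss': "s \<le> s'" "s' \<le> 1"
    using assms(3,4) by (simp_all add: d power_mono power_le_one)
  have p: "p \<le> p'" "0 \<le> p'"
    using assms(2,5) Cauchy_Schwarz_ineq[of r w] by (simp_all add: d norm_eq_1 power2_norm_eq_inner)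
  \<comment> \<open>Writing 1 - s = (s' - s) + (1 - s') and squaring both sides of the claim, only
    the cross terms remain to be compared; this bound handles them.\<close>
  have "1 - s' \<le> sqrt ((1 - s')\<^sup>2 + 4 * p')"
    by (rule real_le_rsqrt) (use p in simp)
  then have "(s' - s) * (1 - s') \<le> (s' - s) * sqrt ((1 - s')\<^sup>2 + 4 * p')"
    using ss' by (intro mult_left_mono) auto
  moreover have "(sqrt ((1 - s')\<^sup>2 + 4 * p'))\<^sup>2 = (1 - s')\<^sup>2 + 4 * p'"
    using p by simp
  ultimately have "(1 - s)\<^sup>2 + 4 * p \<le> ((s' - s) + sqrt ((1 - s')\<^sup>2 + 4 * p'))\<^sup>2"
    using p by (simp add: power2_eq_square algebra_simps)
  then have "sqrt ((1 - s)\<^sup>2 + 4 * p) \<le> (s' - s) + sqrt ((1 - s')\<^sup>2 + 4 * p')"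
    using ss' p by (intro real_le_lsqrt) auto
  then have "(norm (x - u) + norm (x + u))\<^sup>2 \<le> (norm (r - w) + norm (r + w))\<^sup>2"
    unfolding focal_sum_sq[OF assms(1)] focal_sum_sq[OF assms(2)] d(3,4)[symmetric]
    unfolding d(1,2)[symmetric] by argo
  then show ?thesis by (rule power2_le_imp_le) simp
qed

text \<open>The focal axis is mapped into the new focal axis, so a contraction cannot increase the
  distance to the axis.\<close>

lemma focal_sum_contraction:
  fixes f :: "'a::real_inner \<Rightarrow> 'b::real_inner"
  assumes "linear f" "\<And>v. norm (f v) \<le> norm v" "norm w = 1" "norm u = 1" "f w = t *\<^sub>R u"
    and "norm r \<le> 1"
  shows "norm (f r - u) + norm (f r + u) \<le> norm (r - w) + norm (r + w)"
proof (rule focal_sum_mono)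
  have w: "w \<bullet> w = 1" and u: "u \<bullet> u = 1" using assms by (simp_all add: dot_square_norm)
  define c where "c = r \<bullet> w"
  \<comment> \<open>The point \<open>(c * t) *\<^sub>R u\<close> is the image of the orthogonal
    projection of \<open>r\<close> onto the axis; the distance to any point of an axis bounds the
    distance to the axis.\<close>
  have "(norm (f r))\<^sup>2 - (f r \<bullet> u)\<^sup>2 \<le> (norm (f r - (c * t) *\<^sub>R u))\<^sup>2"
  proof -
    have "(norm (f r - (c * t) *\<^sub>R u))\<^sup>2 = (norm (f r))\<^sup>2 - (f r \<bullet> u)\<^sup>2 + (f r \<bullet> u - c * t)\<^sup>2"
      by (simp add: power2_norm_eq_inner inner_diff_left inner_diff_right u
          inner_commute[of u "f r"]) (simp add: power2_eq_square algebra_simps)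
    then show ?thesis by simp
  qed
  also have "f r - (c * t) *\<^sub>R u = f (r - c *\<^sub>R w)"
    using assms(5) by (simp add: linear_diff[OF assms(1)] linear_cmul[OF assms(1)])
  also have "(norm (f (r - c *\<^sub>R w)))\<^sup>2 \<le> (norm (r - c *\<^sub>R w))\<^sup>2"
    using assms(2) by (simp add: power_mono)
  also have "\<dots> = (norm r)\<^sup>2 - (r \<bullet> w)\<^sup>2"
    by (simp add: power2_norm_eq_inner inner_diff_left inner_diff_right w c_def
        inner_commute[of w r]) (simp add: power2_eq_square algebra_simps)
  finally show "(norm (f r))\<^sup>2 - (f r \<bullet> u)\<^sup>2 \<le> (norm r)\<^sup>2 - (r \<bullet> w)\<^sup>2" .
qed (use assms in auto)

lemma focal_sum_segment:
  fixes u :: "'a::real_normed_vector"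
  assumes "norm u = 1" "\<bar>c\<bar> \<le> 1"
  shows "norm (c *\<^sub>R u - u) + norm (c *\<^sub>R u + u) = 2"
proof -
  have "c *\<^sub>R u - u = (c - 1) *\<^sub>R u" "c *\<^sub>R u + u = (c + 1) *\<^sub>R u"
    by (simp_all add: algebra_simps)
  then show ?thesis using assms by simp
qed

section \<open>The nonclassicality of a qubit state in terms of its Bloch vector\<close>

text \<open>The imaginary part comes from the antisymmetric part of a product of Pauli matrices,
  which is i times the cross product.\<close>

lemma trace_mult3_bloch_op:
  "trace (bloch_op m ** bloch_op k ** bloch_op r)
    = Complex ((1 + m \<bullet> k + m \<bullet> r + k \<bullet> r) / 4) (m \<bullet> cross3 k r / 4)"
  by (simp add: trace_def matrix_matrix_mult_def sum_2 bloch_op_nth complex_eq_iff inner_vec3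
      cross3_def) (simp add: field_simps)

text \<open>The right-hand side is the Gram determinant of \<open>m\<close>, \<open>k\<close>,
  \<open>r\<close>.\<close>

lemma triple_product_sq:
  "(m \<bullet> cross3 k r)\<^sup>2 = (m \<bullet> m) * (k \<bullet> k) * (r \<bullet> r) + 2 * (m \<bullet> k) * (k \<bullet> r) * (m \<bullet> r)
    - (m \<bullet> m) * (k \<bullet> r)\<^sup>2 - (k \<bullet> k) * (m \<bullet> r)\<^sup>2 - (r \<bullet> r) * (m \<bullet> k)\<^sup>2"
  by (simp add: inner_vec3 cross3_def power2_eq_square) algebra

text \<open>By the Gram determinant the squared modulus factors. In both factors the dependence on
  \<open>m\<close> is linear, so it cancels when \<open>m\<close> and \<open>- m\<close> are
  added.\<close>

lemma cmod_trace_mult3_bloch_op: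
  fixes m k r :: "real^3"
  assumes "norm m = 1" "norm k = 1"
  defines "g \<equiv> (norm (k + r))\<^sup>2 + (m \<bullet> k) * (1 - r \<bullet> r) + 2 * (m \<bullet> r) + 2 * (m \<bullet> r) * (k \<bullet> r)"
  shows "cmod (trace (bloch_op m ** bloch_op k ** bloch_op r)) = sqrt ((1 + m \<bullet> k) * g) / 4"
    and "0 \<le> 1 + m \<bullet> k" and "0 \<le> g"
proof -
  have mk: "m \<bullet> m = 1" "k \<bullet> k = 1" using assms by (simp_all add: dot_square_norm)
  have L: "(norm (k + r))\<^sup>2 = 1 + 2 * (k \<bullet> r) + r \<bullet> r"
    by (simp add: power2_norm_eq_inner inner_add_left inner_add_right mk inner_commute[of r k])
  have A: "(1 + m \<bullet> k + m \<bullet> r + k \<bullet> r)\<^sup>2 + (m \<bullet> cross3 k r)\<^sup>2 = (1 + m \<bullet> k) * g"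
    unfolding triple_product_sq mk g_def L by (simp add: power2_eq_square algebra_simps)
  have "(1 + m \<bullet> k + m \<bullet> r + k \<bullet> r)\<^sup>2 / 16 + (m \<bullet> cross3 k r)\<^sup>2 / 16 = (1 + m \<bullet> k) * g / 16"
    by (simp only: A add_divide_distrib[symmetric])
  then have "(cmod (trace (bloch_op m ** bloch_op k ** bloch_op r)))\<^sup>2 = (1 + m \<bullet> k) * g / 16"
    unfolding trace_mult3_bloch_op cmod_power2 complex.sel power_divide by simp
  then have "cmod (trace (bloch_op m ** bloch_op k ** bloch_op r)) = sqrt ((1 + m \<bullet> k) * g / 16)"
    by (metis norm_ge_zero real_sqrt_unique)
  then show "cmod (trace (bloch_op m ** bloch_op k ** bloch_op r)) = sqrt ((1 + m \<bullet> k) * g) / 4"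
    by (simp add: real_sqrt_divide)
  have "\<bar>m \<bullet> k\<bar> \<le> 1" using Cauchy_Schwarz_ineq2[of m k] assms by simp
  then show p: "0 \<le> 1 + m \<bullet> k" by linarith
  show "0 \<le> g"
  \<comment> \<open>The product of the factors is a sum of squares, which settles the sign of
    \<open>g\<close> unless the other factor vanishes; then \<open>m = - k\<close> and
    Cauchy-Schwarz applies directly.\<close>
  proof (cases "m \<bullet> k = - 1")
    case True
    then have "(m + k) \<bullet> (m + k) = 0"
      by (simp add: inner_add_left inner_add_right mk inner_commute[of k m])
    then have m: "m = - k" by (simp only: inner_eq_zero_iff eq_neg_iff_add_eq_0)
    show ?thesis
      using Cauchy_Schwarz_ineq[of k r] unfolding g_def L m
      by (simp add: mk power2_eq_square algebra_simps)
  next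
    case False
    with p have "0 < 1 + m \<bullet> k" by simp
    then show ?thesis using A by (metis sum_power2_ge_zero zero_le_mult_iff not_le)
  qed
qed

text \<open>Cauchy-Schwarz in the plane for the vectors of square roots; the cross term is bounded
  by the arithmetic-geometric mean inequality.\<close>

lemma sqrt_mult_add_le:
  assumes "0 \<le> p" "0 \<le> q" "0 \<le> g" "0 \<le> h"
  shows "sqrt (p * g) + sqrt (q * h) \<le> sqrt ((p + q) * (g + h))"
proof (rule real_le_rsqrt)
  have "sqrt (p * g) * sqrt (q * h) = sqrt ((p * h) * (q * g))"
    by (simp add: real_sqrt_mult[symmetric] mult_ac)
  also have "\<dots> \<le> (p * h + q * g) / 2" using assms by (intro arith_geo_mean_sqrt) auto
  finally show "(sqrt (p * g) + sqrt (q * h))\<^sup>2 \<le> (p + q) * (g + h)"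
    using assms by (simp add: power2_sum algebra_simps)
qed

text \<open>Over the antipodal pair the two factors sum to 2 and 2 |k + r|^2, so Cauchy-Schwarz
  gives a bound independent of the basis.\<close>

lemma sum_antipodal_cmod_le:
  assumes "norm m = 1" "norm k = 1"
  shows "cmod (trace (bloch_op (- m) ** bloch_op k ** bloch_op r))
    + cmod (trace (bloch_op m ** bloch_op k ** bloch_op r)) \<le> norm (r + k) / 2"
proof -
  let ?g = "\<lambda>m. (norm (k + r))\<^sup>2 + (m \<bullet> k) * (1 - r \<bullet> r) + 2 * (m \<bullet> r) + 2 * (m \<bullet> r) * (k \<bullet> r)"
  have m': "norm (- m) = 1" using assms by simp
  note 1 = cmod_trace_mult3_bloch_op(1)[OF m' assms(2), of r] cmod_trace_mult3_bloch_op(2)[OF m' assms(2)]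
    cmod_trace_mult3_bloch_op(3)[OF m' assms(2), of r]
  note 2 = cmod_trace_mult3_bloch_op(1)[OF assms, of r] cmod_trace_mult3_bloch_op(2)[OF assms]
    cmod_trace_mult3_bloch_op(3)[OF assms, of r]
  have "sqrt ((1 + (- m) \<bullet> k) * ?g (- m)) + sqrt ((1 + m \<bullet> k) * ?g m)
    \<le> sqrt (((1 + (- m) \<bullet> k) + (1 + m \<bullet> k)) * (?g (- m) + ?g m))"
    by (rule sqrt_mult_add_le[OF 1(2) 2(2) 1(3) 2(3)])
  also have "((1 + (- m) \<bullet> k) + (1 + m \<bullet> k)) * (?g (- m) + ?g m) = (2 * norm (r + k))\<^sup>2"
    by (simp add: power_mult_distrib add.commute)
  also have "sqrt \<dots> = 2 * norm (r + k)"
    by (simp only: real_sqrt_abs) simp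
  finally show ?thesis unfolding 1(1) 2(1) by simp
qed

text \<open>The equality case of the preceding bound: all terms containing \<open>m\<close>
  vanish.\<close>

lemma cmod_trace_mult3_orthogonal:
  assumes "norm m = 1" "norm k = 1" "m \<bullet> k = 0" "m \<bullet> r = 0"
  shows "cmod (trace (bloch_op m ** bloch_op k ** bloch_op r)) = norm (r + k) / 4"
  using cmod_trace_mult3_bloch_op(1)[OF assms(1,2), of r] assms(3,4) by (simp add: add.commute)

lemma ex_unit_orthogonal:
  obtains m :: "real^3" where "norm m = 1" "m \<bullet> k = 0" "m \<bullet> r = 0"
proof -
  have "dim {k, r} < DIM(real^3)"
    using dim_le_card[of "{k, r}" "{k, r}"] card_insert_le_m1[of 2 "{r}" k]
    by (simp add: span_superset)
  then obtain x where x: "x \<noteq> 0" "\<And>y. y \<in> span {k, r} \<Longrightarrow> orthogonal x y"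
    using orthogonal_to_subspace_exists by blast
  have "x \<bullet> k = 0" "x \<bullet> r = 0"
    using x(2) by (simp_all add: span_base orthogonal_def[symmetric])
  with x(1) that[of "x /\<^sub>R norm x"] show thesis by simp
qed

lemma sum_cmod_KD:
  assumes "norm \<nu> = 1" "ketbra (e 1) = bloch_op (- m)" "ketbra (e 2) = bloch_op m"
  shows "(\<Sum>i\<in>UNIV. \<Sum>k\<in>UNIV. cmod (KD \<nu> e \<rho> i k))
    = cmod (trace (bloch_op (- m) ** bloch_op (- \<nu>) ** \<rho>))
      + cmod (trace (bloch_op m ** bloch_op (- \<nu>) ** \<rho>))
      + (cmod (trace (bloch_op (- m) ** bloch_op \<nu> ** \<rho>))
      + cmod (trace (bloch_op m ** bloch_op \<nu> ** \<rho>)))"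
proof -
  have d: "dot_sigma (- \<nu>) = - dot_sigma \<nu>"
    by (simp add: dot_sigma_def sum_negf)
  \<comment> \<open>In the type \<open>2\<close> the numeral 2 equals 0, so index 2 selects the
    eigenvalue 1 and index 1 the eigenvalue -1.\<close>
  have "ref_projector \<nu> 1 = bloch_op (- \<nu>)" "ref_projector \<nu> 2 = bloch_op \<nu>"
    by (simp_all add: ref_projector_eq[OF assms(1)] bloch_op_def d)
  then show ?thesis by (simp add: sum_2 KD_def assms)
qed

text \<open>The maximum over bases is attained at Bloch directions orthogonal to both \<open>\<nu>\<close> and \<open>r\<close>.\<close>

lemma N_KD_bloch_op:
  assumes "norm \<nu> = 1"
  shows "N_KD \<nu> (bloch_op r) = (1/2) * ((norm (r - \<nu>) + norm (r + \<nu>)) / 2 - 1)"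
  unfolding N_KD_def
proof (rule cSup_eq_maximum)
  have \<nu>': "norm (- \<nu>) = 1" using assms by simp
  obtain m where m: "norm m = 1" "m \<bullet> \<nu> = 0" "m \<bullet> r = 0" using ex_unit_orthogonal .
  obtain e where e: "orthonormal_basis e" "ketbra (e 1) = bloch_op (- m)" "ketbra (e 2) = bloch_op m"
    using ex_basis_bloch[OF m(1)] .
  have "(\<Sum>i\<in>UNIV. \<Sum>k\<in>UNIV. cmod (KD \<nu> e (bloch_op r) i k))
    = (norm (r - \<nu>) + norm (r + \<nu>)) / 2"
    unfolding sum_cmod_KD[OF assms e(2,3)]
    by (simp add: cmod_trace_mult3_orthogonal m assms)
  then show "(1/2) * ((norm (r - \<nu>) + norm (r + \<nu>)) / 2 - 1)
    \<in> (\<lambda>e. (1/2) * ((\<Sum>i\<in>UNIV. \<Sum>k\<in>UNIV. cmod (KD \<nu> e (bloch_op r) i k)) - 1))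
      ` Collect orthonormal_basis"
    using e(1) by (intro image_eqI[of _ _ e]) auto
next
  fix y
  assume "y \<in> (\<lambda>e. (1/2) * ((\<Sum>i\<in>UNIV. \<Sum>k\<in>UNIV. cmod (KD \<nu> e (bloch_op r) i k)) - 1))
      ` Collect orthonormal_basis"
  then obtain e where e: "orthonormal_basis e"
    "y = (1/2) * ((\<Sum>i\<in>UNIV. \<Sum>k\<in>UNIV. cmod (KD \<nu> e (bloch_op r) i k)) - 1)"
    by auto
  obtain m where m: "norm m = 1" "ketbra (e 1) = bloch_op (- m)" "ketbra (e 2) = bloch_op m"
    using orthonormal_basis_bloch[OF e(1)] .
  have "(\<Sum>i\<in>UNIV. \<Sum>k\<in>UNIV. cmod (KD \<nu> e (bloch_op r) i k))
    \<le> norm (r - \<nu>) / 2 + norm (r + \<nu>) / 2"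
    unfolding sum_cmod_KD[OF assms m(2,3)]
    using sum_antipodal_cmod_le[OF m(1), of "- \<nu>" r] sum_antipodal_cmod_le[OF m(1), of \<nu> r] assms
    by (intro add_mono) simp_all
  then show "y \<le> (1/2) * ((norm (r - \<nu>) + norm (r + \<nu>)) / 2 - 1)"
    by (simp add: e(2))
qed

section \<open>Steered states and channels\<close>

lemma sum_UNIV_prod: "(\<Sum>p\<in>UNIV. f p) = (\<Sum>i\<in>UNIV. \<Sum>j\<in>UNIV. f (i, j))"
  for f :: "'a::finite \<times> 'b::finite \<Rightarrow> 'c::comm_monoid_add"
  by (simp add: sum.cartesian_product)

text \<open>The unnormalized conditional state, which avoids the division by the probability and is
  linear in both arguments.\<close>

definition steered :: "two_qubit_op \<Rightarrow> qubit_op \<Rightarrow> qubit_op" where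
  "steered \<rho> M = ptrace_A ((M \<otimes> mat 1) ** \<rho>)"

lemma steered_nth:
  "steered \<rho> M $ k $ l = (\<Sum>i\<in>UNIV. \<Sum>j\<in>UNIV. M $ i $ j * \<rho> $ (j, k) $ (i, l))"
  by (simp add: steered_def ptrace_A_def kron_def matrix_matrix_mult_def sum_UNIV_prod mat_def
      if_distrib[of "\<lambda>x. _ * x"] if_distrib[of "\<lambda>x. x * _"] cong: if_cong)

lemma trace_ptrace_A: "trace (ptrace_A X) = trace X"
  unfolding trace_def ptrace_A_def sum_UNIV_prod by (subst sum.swap) simp

lemma outcome_prob_steered: "outcome_prob \<rho> M = Re (trace (steered \<rho> M))"
  by (simp add: outcome_prob_def steered_def trace_ptrace_A)

lemma cond_state_steered: "cond_state \<rho> M = steered \<rho> M /\<^sub>R outcome_prob \<rho> M"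
  by (simp add: cond_state_def steered_def)

text \<open>The trivial measurement exhibits Bob's marginal as a conditional state.\<close>

lemma steered_mat_1: "steered \<rho> (mat 1) = ptrace_A \<rho>"
  by (simp add: vec_eq_iff steered_nth ptrace_A_def mat_def
      if_distrib[of "\<lambda>x. x * _"] cong: if_cong)

lemma outcome_prob_mat_1: "outcome_prob \<rho> (mat 1) = Re (trace \<rho>)"
  by (simp add: outcome_prob_steered steered_mat_1 trace_ptrace_A)

lemma outcome_prob_add: "outcome_prob \<rho> (M + N) = outcome_prob \<rho> M + outcome_prob \<rho> N"
  by (simp add: outcome_prob_steered trace_def sum_2 steered_nth algebra_simps)

lemma sum_outcome_prob: "(\<Sum>M\<leftarrow>Ms. outcome_prob \<rho> M) = outcome_prob \<rho> (sum_list Ms)"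
proof (induction Ms)
  case Nil
  show ?case by (simp add: outcome_prob_steered trace_def sum_2 steered_nth)
qed (simp add: outcome_prob_add)

text \<open>A vector \<open>v\<close> of Bob turns the two-qubit form of \<open>\<rho>\<close> into a positive operator \<open>S\<close> of Alice,
  and the quadratic form of the steered operator at \<open>v\<close> is the trace of \<open>M ** S\<close>.\<close>

lemma psd_steered:
  assumes "psd \<rho>" "psd M"
  shows "psd (steered \<rho> M)"
  unfolding psd_def Let_def
proof
  fix v :: "complex^2"
  define S :: qubit_op where
    "S = (\<chi> j i. \<Sum>k\<in>UNIV. \<Sum>l\<in>UNIV. cnj (v $ k) * \<rho> $ (j, k) $ (i, l) * v $ l)"
  have "psd S"
    unfolding psd_def
  proof
    fix u :: "complex^2"
    define w :: "complex^(2 \<times> 2)" where "w = (\<chi> p. u $ fst p * v $ snd p)"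
    have "(\<Sum>i\<in>UNIV. cnj (u $ i) * (S *v u) $ i) = (\<Sum>p\<in>UNIV. cnj (w $ p) * (\<rho> *v w) $ p)"
      by (simp add: S_def w_def matrix_vector_mult_def sum_UNIV_prod sum_2 algebra_simps)
    then show "let q = (\<Sum>i\<in>UNIV. cnj (u $ i) * (S *v u) $ i) in Im q = 0 \<and> 0 \<le> Re q"
      using assms(1) by (simp add: psd_def Let_def)
  qed
  have "(\<Sum>i\<in>UNIV. cnj (v $ i) * (steered \<rho> M *v v) $ i) = trace (M ** S)"
    by (simp add: S_def matrix_vector_mult_def matrix_matrix_mult_def trace_def steered_nth sum_2
        algebra_simps)
  then show "Im (\<Sum>i\<in>UNIV. cnj (v $ i) * (steered \<rho> M *v v) $ i) = 0
    \<and> 0 \<le> Re (\<Sum>i\<in>UNIV. cnj (v $ i) * (steered \<rho> M *v v) $ i)"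
    using psd_qubit_trace_mult[OF assms(2) \<open>psd S\<close>] by simp
qed

lemma outcome_prob_nonneg:
  assumes "psd \<rho>" "psd M"
  shows "0 \<le> outcome_prob \<rho> M"
  using psd_steered[OF assms] norm_ge_zero[of "bloch_vec (steered \<rho> M)"]
  unfolding psd_qubit_iff outcome_prob_steered by linarith

lemma cond_state_bloch:
  assumes "psd \<rho>" "psd M" "outcome_prob \<rho> M \<noteq> 0"
  shows "cond_state \<rho> M = bloch_op (bloch_vec (cond_state \<rho> M))"
    and "norm (bloch_vec (cond_state \<rho> M)) \<le> 1"
proof -
  let ?p = "outcome_prob \<rho> M" and ?Y = "steered \<rho> M"
  have Y: "hadj ?Y = ?Y" "norm (bloch_vec ?Y) \<le> ?p"
    using psd_steered[OF assms(1,2)] by (simp_all add: psd_qubit_iff outcome_prob_steered)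
  have p: "0 < ?p" using assms outcome_prob_nonneg[OF assms(1,2)] by simp
  have "hadj (cond_state \<rho> M) = cond_state \<rho> M"
    using Y(1) by (simp add: cond_state_steered hadj_def vec_eq_iff)
  moreover have "Re (trace (cond_state \<rho> M)) = 1"
  proof -
    have "Re (trace (c *\<^sub>R X)) = c * Re (trace X)" for c and X :: qubit_op
      by (simp add: trace_def sum_2 distrib_left)
    then show ?thesis using assms(3) by (simp add: cond_state_steered outcome_prob_steered)
  qed
  ultimately show "cond_state \<rho> M = bloch_op (bloch_vec (cond_state \<rho> M))"
    by (simp add: bloch_op_bloch_vec)
  show "norm (bloch_vec (cond_state \<rho> M)) \<le> 1"
    using Y(2) p by (simp add: cond_state_steered bloch_vec_scaleR field_simps)
qed

section \<open>Compatibility of Bob's channel with steering by Alice\<close>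

lemma complex_linear_op_scaleR:
  assumes "complex_linear_op \<Lambda>"
  shows "\<Lambda> (c *\<^sub>R X) = c *\<^sub>R \<Lambda> X"
proof -
  have "mat (complex_of_real c) ** Y = c *\<^sub>R Y" for Y :: qubit_op
    by (simp add: vec_eq_iff forall_2 matrix_matrix_mult_def mat_def sum_2 complex_eq_iff)
  then show ?thesis using assms unfolding complex_linear_op_def by metis
qed

text \<open>The steered operator is a complex linear combination of the blocks of
  \<open>\<rho>\<close>, and the map acts on each block.\<close>

lemma steered_id_tensor:
  assumes "complex_linear_op \<Lambda>"
  shows "steered (id_tensor \<Lambda> \<rho>) M = \<Lambda> (steered \<rho> M)"
proof -
  define X :: "2 \<Rightarrow> 2 \<Rightarrow> qubit_op" where "X j i = (\<chi> k l. \<rho> $ (j, k) $ (i, l))" for j i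
  have add: "\<Lambda> (A + B) = \<Lambda> A + \<Lambda> B" and scale: "\<Lambda> (mat c ** A) = mat c ** \<Lambda> A" for A B c
    using assms by (simp_all add: complex_linear_op_def)
  have m: "(mat c ** A) $ k $ l = c * A $ k $ l" for c k l and A :: qubit_op
    by (simp add: matrix_matrix_mult_def mat_def if_distrib[of "\<lambda>x. x * _"] cong: if_cong)
  \<comment> \<open>The partial trace pairs entry (i, j) of \<open>M\<close> with block (j, i),
    hence the transposed indices.\<close>
  have "steered \<rho> M = mat (M $ 1 $ 1) ** X 1 1 + mat (M $ 1 $ 2) ** X 2 1
    + mat (M $ 2 $ 1) ** X 1 2 + mat (M $ 2 $ 2) ** X 2 2"
    by (simp add: vec_eq_iff steered_nth m sum_2 X_def)
  moreover have "steered (id_tensor \<Lambda> \<rho>) M = mat (M $ 1 $ 1) ** \<Lambda> (X 1 1)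
    + mat (M $ 1 $ 2) ** \<Lambda> (X 2 1) + mat (M $ 2 $ 1) ** \<Lambda> (X 1 2) + mat (M $ 2 $ 2) ** \<Lambda> (X 2 2)"
    by (simp add: vec_eq_iff steered_nth m sum_2 X_def id_tensor_def)
  ultimately show ?thesis by (simp add: add scale)
qed

text \<open>Complete positivity with an ancilla of dimension 1.\<close>

lemma unital_channel_psd:
  assumes "unital_channel \<Lambda>" "psd X"
  shows "psd (\<Lambda> X)"
proof -
  have "block_psd 1 (\<lambda>_ _. X)"
    using assms(2) by (simp add: block_psd_def psd_def Let_def)
  then have "block_psd 1 (\<lambda>_ _. \<Lambda> X)"
    using assms(1) unfolding unital_channel_def completely_positive_def by blast
  then have *: "let q = (\<Sum>i<1. \<Sum>j<1. \<Sum>k\<in>UNIV. cnj (w i $ k) * (\<Lambda> X *v w j) $ k)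
      in Im q = 0 \<and> 0 \<le> Re q" for w :: "nat \<Rightarrow> complex^2"
    unfolding block_psd_def by blast
  show ?thesis
    unfolding psd_def using *[of "\<lambda>_. v" for v] by (simp add: Let_def)
qed

section \<open>Comparison of two states with the same outcome statistics\<close>

lemma povm_mat_1: "povm [mat 1]"
  by (simp add: povm_def psd_qubit_iff bloch_vec_def pauli_def trace_def matrix_matrix_mult_def
      sum_2 sum_3 mat_def hadj_def vec_eq_iff norm_vec_def L2_set_def)

lemma avg_N_KD_mono:
  assumes "povm Ms" "\<And>M. psd M \<Longrightarrow> 0 \<le> outcome_prob \<rho> M"
    and "\<And>M. psd M \<Longrightarrow> outcome_prob \<rho>' M = outcome_prob \<rho> M"
    and "\<And>M. M \<in> set Ms \<Longrightarrow> outcome_prob \<rho> M \<noteq> 0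
      \<Longrightarrow> N_KD (ref_dir \<rho>') (cond_state \<rho>' M) \<le> N_KD (ref_dir \<rho>) (cond_state \<rho> M)"
  shows "avg_N_KD \<rho>' Ms \<le> avg_N_KD \<rho> Ms"
  unfolding avg_N_KD_def
proof (rule sum_list_mono)
  fix M assume M: "M \<in> set Ms"
  then have "psd M" using assms(1) by (simp add: povm_def)
  then show "outcome_prob \<rho>' M * N_KD (ref_dir \<rho>') (cond_state \<rho>' M)
    \<le> outcome_prob \<rho> M * N_KD (ref_dir \<rho>) (cond_state \<rho> M)"
    \<comment> \<open>An outcome of probability zero contributes 0 on both sides, whatever its
      conditional state evaluates to.\<close>
    using assms(2-4) M by (cases "outcome_prob \<rho> M = 0") (auto intro: mult_left_mono)
qed

text \<open>The outcome probabilities of a POVM sum to the probability of the identity, so the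
  average is a convex combination.\<close>

lemma avg_N_KD_le:
  assumes "povm Ms" "\<And>M. psd M \<Longrightarrow> 0 \<le> outcome_prob \<rho> M" "outcome_prob \<rho> (mat 1) = 1"
    and "\<And>M. psd M \<Longrightarrow> outcome_prob \<rho> M \<noteq> 0 \<Longrightarrow> N_KD (ref_dir \<rho>) (cond_state \<rho> M) \<le> K"
  shows "avg_N_KD \<rho> Ms \<le> K"
proof -
  have "avg_N_KD \<rho> Ms \<le> (\<Sum>M\<leftarrow>Ms. outcome_prob \<rho> M * K)"
    unfolding avg_N_KD_def
  proof (rule sum_list_mono)
    fix M assume "M \<in> set Ms"
    then have "psd M" using assms(1) by (simp add: povm_def)
    then show "outcome_prob \<rho> M * N_KD (ref_dir \<rho>) (cond_state \<rho> M) \<le> outcome_prob \<rho> M * K"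
      using assms(2,4) by (cases "outcome_prob \<rho> M = 0") (auto intro: mult_left_mono)
  qed
  also have "\<dots> = K"
    using assms(1,3) by (simp add: sum_list_mult_const sum_outcome_prob povm_def)
  finally show ?thesis .
qed

text \<open>The bound \<open>K\<close> makes the set of values bounded above, as needed to compare
  an element with its supremum.\<close>

lemma N_KD_le_R_KD:
  assumes "\<And>M. psd M \<Longrightarrow> outcome_prob \<rho> M \<noteq> 0 \<Longrightarrow> N_KD (ref_dir \<rho>) (cond_state \<rho> M) \<le> K"
    and "povm Ms" "M \<in> set Ms" "outcome_prob \<rho> M \<noteq> 0"
  shows "N_KD (ref_dir \<rho>) (cond_state \<rho> M) \<le> R_KD \<rho>"
  unfolding R_KD_def
proof (rule cSup_upper)
  show "bdd_above {N_KD (ref_dir \<rho>) (cond_state \<rho> M) |Ms M.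
      povm Ms \<and> M \<in> set Ms \<and> outcome_prob \<rho> M \<noteq> 0}"
    by (rule bdd_aboveI[of _ K]) (use assms(1) in \<open>auto simp: povm_def\<close>)
qed (use assms(2-) in blast)

lemma avg_N_KD_le_C_KD:
  assumes "\<And>M. psd M \<Longrightarrow> 0 \<le> outcome_prob \<rho> M" "outcome_prob \<rho> (mat 1) = 1"
    and "\<And>M. psd M \<Longrightarrow> outcome_prob \<rho> M \<noteq> 0 \<Longrightarrow> N_KD (ref_dir \<rho>) (cond_state \<rho> M) \<le> K"
    and "povm Ms"
  shows "avg_N_KD \<rho> Ms \<le> C_KD \<rho>"
  unfolding C_KD_def
proof (rule cSUP_upper)
  show "bdd_above (avg_N_KD \<rho> ` Collect povm)"
    by (rule bdd_aboveI2[of _ _ K]) (use avg_N_KD_le[OF _ assms(1-3)] in simp)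
qed (use assms(4) in simp)

text \<open>Stated for arbitrary operators so that it can be used in both directions when
  \<open>D\<close> is orthogonal.\<close>

lemma R_KD_mono:
  assumes "outcome_prob \<rho> (mat 1) = 1"
    and "\<And>M. psd M \<Longrightarrow> outcome_prob \<rho>' M = outcome_prob \<rho> M"
    and "\<And>M. psd M \<Longrightarrow> outcome_prob \<rho> M \<noteq> 0
      \<Longrightarrow> N_KD (ref_dir \<rho>') (cond_state \<rho>' M) \<le> N_KD (ref_dir \<rho>) (cond_state \<rho> M)"
    and "\<And>M. psd M \<Longrightarrow> outcome_prob \<rho> M \<noteq> 0 \<Longrightarrow> N_KD (ref_dir \<rho>) (cond_state \<rho> M) \<le> K"
  shows "R_KD \<rho>' \<le> R_KD \<rho>"
  unfolding R_KD_def[of \<rho>']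
proof (rule cSup_least)
  \<comment> \<open>The trivial measurement shows that the supremum is over a nonempty set.\<close>
  have "outcome_prob \<rho>' (mat 1) = 1"
    using assms(1,2) povm_mat_1 by (simp add: povm_def)
  then show "{N_KD (ref_dir \<rho>') (cond_state \<rho>' M) |Ms M.
      povm Ms \<and> M \<in> set Ms \<and> outcome_prob \<rho>' M \<noteq> 0} \<noteq> {}"
    using povm_mat_1 by force
next
  fix y
  assume "y \<in> {N_KD (ref_dir \<rho>') (cond_state \<rho>' M) |Ms M.
      povm Ms \<and> M \<in> set Ms \<and> outcome_prob \<rho>' M \<noteq> 0}"
  then obtain Ms M where M: "povm Ms" "M \<in> set Ms" "outcome_prob \<rho>' M \<noteq> 0"
    and y: "y = N_KD (ref_dir \<rho>') (cond_state \<rho>' M)" by blast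
  then have "psd M" by (simp add: povm_def)
  with M assms(2) have "outcome_prob \<rho> M \<noteq> 0" by simp
  with y assms(3)[OF \<open>psd M\<close>] N_KD_le_R_KD[OF assms(4) M(1,2)] show "y \<le> R_KD \<rho>"
    by (meson order_trans)
qed

lemma C_KD_mono:
  assumes "\<And>M. psd M \<Longrightarrow> 0 \<le> outcome_prob \<rho> M" "outcome_prob \<rho> (mat 1) = 1"
    and "\<And>M. psd M \<Longrightarrow> outcome_prob \<rho>' M = outcome_prob \<rho> M"
    and "\<And>M. psd M \<Longrightarrow> outcome_prob \<rho> M \<noteq> 0
      \<Longrightarrow> N_KD (ref_dir \<rho>') (cond_state \<rho>' M) \<le> N_KD (ref_dir \<rho>) (cond_state \<rho> M)"
    and "\<And>M. psd M \<Longrightarrow> outcome_prob \<rho> M \<noteq> 0 \<Longrightarrow> N_KD (ref_dir \<rho>) (cond_state \<rho> M) \<le> K"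
  shows "C_KD \<rho>' \<le> C_KD \<rho>"
  unfolding C_KD_def[of \<rho>']
proof (rule cSUP_least)
  show "Collect povm \<noteq> {}" using povm_mat_1 by blast
next
  fix Ms assume "Ms \<in> Collect povm"
  then have Ms: "povm Ms" by simp
  then have "avg_N_KD \<rho>' Ms \<le> avg_N_KD \<rho> Ms"
    by (rule avg_N_KD_mono) (use assms Ms in \<open>auto simp: povm_def\<close>)
  also have "\<dots> \<le> C_KD \<rho>" by (rule avg_N_KD_le_C_KD[OF assms(1,2,5) Ms])
  finally show "avg_N_KD \<rho>' Ms \<le> C_KD \<rho>" .
qed

lemma bloch_vec_ptrace_A_two_qubit: "bloch_vec (ptrace_A (two_qubit a b T)) = b"
  by (simp add: vec_eq_iff bloch_vec_def ptrace_A_def two_qubit_def kron_def trace_def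
      matrix_matrix_mult_def forall_3 sum_3 sum_2 pauli_def dot_sigma_def mat_def)
    (simp add: field_simps)

theorem theorem7:
  fixes \<rho> \<rho>' :: two_qubit_op and a b n n' :: "real^3" and T D :: "real^3^3"
    and \<Lambda> :: "qubit_op \<Rightarrow> qubit_op"
  assumes "density_op \<rho>" and "\<rho> = two_qubit a b T"
    and "b \<noteq> 0" and "n = b /\<^sub>R norm b"
    and "unital_channel \<Lambda>"
    and "\<And>v. norm v \<le> 1 \<Longrightarrow> \<Lambda> (bloch_op v) = bloch_op (D *v v)"
    and "D *v b \<noteq> 0" and "n' = (D *v b) /\<^sub>R norm (D *v b)"
    and "\<rho>' = id_tensor \<Lambda> \<rho>"
  shows "onorm (\<lambda>v. D *v v) \<le> 1
    \<and> R_KD \<rho>' \<le> R_KD \<rho> \<and> C_KD \<rho>' \<le> C_KD \<rho>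
    \<and> (orthogonal_matrix D \<longrightarrow> R_KD \<rho>' = R_KD \<rho> \<and> C_KD \<rho>' = C_KD \<rho>)
    \<and> (\<forall>r. norm r \<le> 1 \<longrightarrow>
          norm (D *v r - n') + norm (D *v r + n') \<le> norm (r - n) + norm (r + n))
    \<and> (\<forall>r. norm r \<le> 1 \<and> aligned n r \<longrightarrow>
          norm (D *v r - n') + norm (D *v r + n') = norm (r - n) + norm (r + n))
    \<and> ((\<exists>Ms M. povm Ms \<and> M \<in> set Ms \<and> outcome_prob \<rho> M \<noteq> 0
            \<and> N_KD (ref_dir \<rho>) (cond_state \<rho> M) = R_KD \<rho>
            \<and> aligned n (bloch_vec (cond_state \<rho> M)))
          \<longrightarrow> R_KD \<rho>' = R_KD \<rho>)
    \<and> ((\<exists>Ms. povm Ms \<and> avg_N_KD \<rho> Ms = C_KD \<rho>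
            \<and> (\<forall>M \<in> set Ms. outcome_prob \<rho> M \<noteq> 0 \<longrightarrow> aligned n (bloch_vec (cond_state \<rho> M))))
          \<longrightarrow> C_KD \<rho>' = C_KD \<rho>)"
proof -
  note \<rho>' = assms(9)
  have psd: "psd \<rho>" and tr: "trace \<rho> = 1" using assms(1) by (simp_all add: density_op_def)
  have n: "norm n = 1" and n': "norm n' = 1" using assms(3,4,7,8) by simp_all
  have lin: "complex_linear_op \<Lambda>" and tp: "trace (\<Lambda> X) = trace X" for X
    using assms(5) by (simp_all add: unital_channel_def)

  \<comment> \<open>The channel maps states to states, so \<open>D\<close> preserves the Bloch ball;
    homogeneity then makes it a contraction.\<close>
  have ball: "norm (D *v v) \<le> 1" if "norm v \<le> 1" for v
    using unital_channel_psd[OF assms(5), of "bloch_op v"] assms(6)[OF that] that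
    by (simp add: psd_bloch_op_iff)
  have D_le: "norm (D *v v) \<le> norm v" for v
  proof (cases "v = 0")
    case False
    have "D *v v = norm v *\<^sub>R (D *v (v /\<^sub>R norm v))"
      using False by (simp add: matrix_vector_mult_scaleR)
    then have "norm (D *v v) = norm v * norm (D *v (v /\<^sub>R norm v))" by (metis norm_scaleR abs_norm_cancel)
    also have "\<dots> \<le> norm v * 1" using False by (intro mult_left_mono ball) auto
    finally show ?thesis by simp
  qed simp
  \<comment> \<open>The factor by which \<open>D\<close> scales lengths along
    \<open>n\<close>.\<close>
  define t where "t = norm (D *v b) / norm b"
  have t: "0 \<le> t" "t \<le> 1" using D_le[of b] assms(3) by (simp_all add: t_def)
  have Dn: "D *v n = t *\<^sub>R n'"
    using assms(3,7) by (simp add: assms(4,8) t_def matrix_vector_mult_scaleR inverse_eq_divide)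

  have p1: "outcome_prob \<rho> (mat 1) = 1" by (simp add: outcome_prob_mat_1 tr)
  have p_nonneg: "0 \<le> outcome_prob \<rho> M" if "psd M" for M
    by (rule outcome_prob_nonneg[OF psd that])
  have p_eq: "outcome_prob \<rho>' M = outcome_prob \<rho> M" for M
    by (simp add: \<rho>' outcome_prob_steered steered_id_tensor[OF lin] tp)
  have cond': "cond_state \<rho>' M = \<Lambda> (cond_state \<rho> M)" for M
    by (simp only: cond_state_steered p_eq complex_linear_op_scaleR[OF lin])
      (simp add: \<rho>' steered_id_tensor[OF lin])

  have dir: "ref_dir \<rho> = n" by (simp add: assms(2,4) ref_dir_two_qubit)
  have dir': "ref_dir \<rho>' = n'"
  proof -
    \<comment> \<open>The action of \<open>\<Lambda>\<close> is known on Bloch operators in the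
      ball. Viewing the marginal as the conditional state of the trivial measurement puts it in that
      form.\<close>
    have c: "cond_state \<rho> (mat 1) = ptrace_A \<rho>" "cond_state \<rho>' (mat 1) = ptrace_A \<rho>'"
      by (simp_all add: cond_state_steered p_eq p1 steered_mat_1)
    have bv: "bloch_vec (ptrace_A \<rho>) = b" by (simp add: assms(2) bloch_vec_ptrace_A_two_qubit)
    have "psd (mat 1 :: qubit_op)" using povm_mat_1 by (simp add: povm_def)
    from cond_state_bloch[OF psd this] have "ptrace_A \<rho> = bloch_op b" "norm b \<le> 1"
      unfolding c bv using p1 by simp_all
    then have "ptrace_A \<rho>' = bloch_op (D *v b)" using cond'[of "mat 1"] assms(6) by (simp add: c)
    then show ?thesis by (simp add: ref_dir_def bloch_vec_bloch_op assms(8) Let_def)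
  qed

  define r where "r M = bloch_vec (cond_state \<rho> M)" for M
  have r: "norm (r M) \<le> 1"
    and N: "N_KD (ref_dir \<rho>) (cond_state \<rho> M)
        = (1/2) * ((norm (r M - n) + norm (r M + n)) / 2 - 1)"
    and N': "N_KD (ref_dir \<rho>') (cond_state \<rho>' M)
        = (1/2) * ((norm (D *v r M - n') + norm (D *v r M + n')) / 2 - 1)"
    if "psd M" "outcome_prob \<rho> M \<noteq> 0" for M
  proof -
    note c = cond_state_bloch[OF psd that, folded r_def]
    show "norm (r M) \<le> 1" by (rule c(2))
    show "N_KD (ref_dir \<rho>) (cond_state \<rho> M) = (1/2) * ((norm (r M - n) + norm (r M + n)) / 2 - 1)"
      unfolding dir c(1) by (rule N_KD_bloch_op[OF n])
    show "N_KD (ref_dir \<rho>') (cond_state \<rho>' M)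
        = (1/2) * ((norm (D *v r M - n') + norm (D *v r M + n')) / 2 - 1)"
      unfolding dir' cond' c(1) assms(6)[OF c(2)] by (rule N_KD_bloch_op[OF n'])
  qed

  have pointwise: "norm (D *v r - n') + norm (D *v r + n') \<le> norm (r - n) + norm (r + n)"
    if "norm r \<le> 1" for r
    by (rule focal_sum_contraction[where f = "(*v) D", OF _ D_le n n' Dn that]) simp
  have pointwise_eq: "norm (D *v r - n') + norm (D *v r + n') = norm (r - n) + norm (r + n)"
    if r: "norm r \<le> 1" "aligned n r" for r
  proof -
    obtain c where c: "r = c *\<^sub>R n"
      \<comment> \<open>All three cases are multiples of \<open>n\<close>, with coefficient 0 for
        the zero vector.\<close>
      using r(2) unfolding aligned_def by (metis scaleR_zero_left)
    then have "\<bar>c\<bar> \<le> 1" using r(1) n by simp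
    then have "\<bar>c * t\<bar> \<le> 1" using t by (simp add: abs_mult mult_le_one)
    moreover have "D *v r = (c * t) *\<^sub>R n'" by (simp add: c matrix_vector_mult_scaleR Dn)
    ultimately show ?thesis
      using focal_sum_segment[OF n \<open>\<bar>c\<bar> \<le> 1\<close>] focal_sum_segment[OF n'] by (simp add: c)
  qed

  \<comment> \<open>Comparison of branches and of the optimized quantities\<close>
  have le: "N_KD (ref_dir \<rho>') (cond_state \<rho>' M) \<le> N_KD (ref_dir \<rho>) (cond_state \<rho> M)"
    if "psd M" "outcome_prob \<rho> M \<noteq> 0" for M
    using pointwise[OF r[OF that]] by (simp add: N[OF that] N'[OF that])
  have eq: "N_KD (ref_dir \<rho>') (cond_state \<rho>' M) = N_KD (ref_dir \<rho>) (cond_state \<rho> M)"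
    if "psd M" "outcome_prob \<rho> M \<noteq> 0" "aligned n (bloch_vec (cond_state \<rho> M))" for M
    using pointwise_eq[OF r[OF that(1,2)]] that(3) by (simp add: N[OF that(1,2)] N'[OF that(1,2)] r_def)
  \<comment> \<open>Both focal distances are at most 2 in the unit ball; this crude estimate
    suffices for boundedness of the suprema.\<close>
  have bound: "N_KD (ref_dir \<rho>) (cond_state \<rho> M) \<le> 1/2" if "psd M" "outcome_prob \<rho> M \<noteq> 0" for M
    using norm_triangle_ineq4[of "r M" n] norm_triangle_ineq[of "r M" n] r[OF that] n
    by (simp add: N[OF that])
  have bound': "N_KD (ref_dir \<rho>') (cond_state \<rho>' M) \<le> 1/2"
    if "psd M" "outcome_prob \<rho>' M \<noteq> 0" for M
    using le[of M] bound[of M] that by (simp add: p_eq)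

  have R_le: "R_KD \<rho>' \<le> R_KD \<rho>" by (rule R_KD_mono[OF p1 p_eq le bound])
  have C_le: "C_KD \<rho>' \<le> C_KD \<rho>" by (rule C_KD_mono[OF p_nonneg p1 p_eq le bound])
  have orth: "R_KD \<rho>' = R_KD \<rho> \<and> C_KD \<rho>' = C_KD \<rho>" if "orthogonal_matrix D"
  proof -
    have iso: "norm (D *v v) = norm v" for v
      using that orthogonal_transformation_matrix[of "(*v) D"]
      by (simp add: orthogonal_transformation)
    \<comment> \<open>For an isometry \<open>t\<close> is 1, so \<open>D\<close> carries the old
      foci to the new ones and preserves both distances.\<close>
    have "n' = D *v n" using Dn assms(3) by (simp add: t_def iso)
    then have "D *v r - n' = D *v (r - n)" "D *v r + n' = D *v (r + n)" for r
      by (simp_all add: matrix_vector_mult_diff_distrib matrix_vector_right_distrib)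
    then have ge: "N_KD (ref_dir \<rho>) (cond_state \<rho> M) \<le> N_KD (ref_dir \<rho>') (cond_state \<rho>' M)"
      if "psd M" "outcome_prob \<rho>' M \<noteq> 0" for M
      using that by (simp add: p_eq N N' iso)
    have "R_KD \<rho> \<le> R_KD \<rho>'"
      by (rule R_KD_mono[OF _ _ ge bound']) (simp_all add: p_eq p1)
    moreover have "C_KD \<rho> \<le> C_KD \<rho>'"
      by (rule C_KD_mono[OF _ _ _ ge bound']) (simp_all add: p_eq p1 p_nonneg)
    ultimately show ?thesis using R_le C_le by simp
  qed
  have R_eq: "R_KD \<rho>' = R_KD \<rho>"
    if "povm Ms" "M \<in> set Ms" "outcome_prob \<rho> M \<noteq> 0"
      "N_KD (ref_dir \<rho>) (cond_state \<rho> M) = R_KD \<rho>"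
      "aligned n (bloch_vec (cond_state \<rho> M))" for Ms M
  proof -
    have "psd M" using that by (simp add: povm_def)
    \<comment> \<open>The optimal aligned branch keeps its value under the channel and competes in
      the supremum for \<open>\<rho>'\<close>.\<close>
    then have "R_KD \<rho> = N_KD (ref_dir \<rho>') (cond_state \<rho>' M)" using eq that by simp
    also have "\<dots> \<le> R_KD \<rho>'"
      by (rule N_KD_le_R_KD[OF bound' that(1,2)]) (use that in \<open>simp_all add: p_eq\<close>)
    finally show ?thesis using R_le by simp
  qed
  have C_eq: "C_KD \<rho>' = C_KD \<rho>"
    if Ms: "povm Ms" "avg_N_KD \<rho> Ms = C_KD \<rho>"
      "\<forall>M \<in> set Ms. outcome_prob \<rho> M \<noteq> 0 \<longrightarrow> aligned n (bloch_vec (cond_state \<rho> M))" for Ms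
  proof -
    have "psd M" if "M \<in> set Ms" for M using that Ms(1) by (simp add: povm_def)
    \<comment> \<open>The comparison of averages is applied with the two states exchanged, since
      every branch of nonzero probability keeps its value.\<close>
    then have "avg_N_KD \<rho> Ms \<le> avg_N_KD \<rho>' Ms"
      by (intro avg_N_KD_mono[OF Ms(1)]) (use Ms(3) eq in \<open>auto simp: p_eq p_nonneg\<close>)
    also have "\<dots> \<le> C_KD \<rho>'"
      by (rule avg_N_KD_le_C_KD[OF _ _ bound' Ms(1)]) (simp_all add: p_eq p1 p_nonneg)
    finally show ?thesis using C_le Ms(2) by simp
  qed
  have "onorm (\<lambda>v. D *v v) \<le> 1" by (rule onorm_le) (simp add: D_le)
  with R_le C_le orth pointwise pointwise_eq R_eq C_eq show ?thesis by blast
qed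

end
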